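(* Let $f,h_1\in\mathbb{Z}[X]$ and let $(a_n)_{n\in\mathbb{N}}$ be given by $a_0=h_1(0)$, $a_n=f(n)a_{n-1}+h_1(n)$ for $n>0$. Let $p$ be a prime number, $k$ a positive integer and $n_0\in\mathbb{N}$. Consider either the case (i) $f(n_0)=0$, in which we put $M_j=n_0$ for all $j\in\mathbb{N}$, or the case (ii) $p\mid f(n_0)$, in which we put $M_j=n_0+jp$ for all $j\in\mathbb{N}$. In either case, let $n_k\ge M_k$ be an integer such that $p^k\mid a_{n_k}$. Then: (1) If $v_p(a_{n_k+p}-a_{n_k})=1$, then there exists a unique $n_{k+1}$ modulo $p^{k+1}$ such that $n_{k+1}\equiv n_k\pmod{p^k}$ and $p^{k+1}\mid a_n$ for all $n\ge M_k$ congruent to $n_{k+1}$ modulo $p^{k+1}$. Moreover, $n_{k+1}\equiv n_k-\frac{p\,a_{n_k}}{a_{n_k+p}-a_{n_k}}\pmod{p^{k+1}}$. (2) If $v_p(a_{n_k+p}-a_{n_k})>1$ and $p^{k+1}\mid a_{n_k}$, then $p^{k+1}\mid a_n$ for any $n$ satisfying $n\equiv n_k\pmod{p^k}$ and $n\ge M_k$. (3) If $v_p(a_{n_k+p}-a_{n_k})>1$ and $p^{k+1}\nmid a_{n_k}$, then $p^{k+1}\nmid a_n$ for any $n$ satisfying $n\equiv n_k\pmod{p^k}$ and $n\ge M_k$. In particular, if $k=1$, $p\mid a_{n_1}$ and $v_p(a_{n_1+p}-a_{n_1})=1$, then for any positive integer $l$ there exists a unique $n_l$ modulo $p^l$ such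 that $n_l\equiv n_1\pmod p$ and $v_p(a_n)\ge l$ for all $n\ge M_{l-1}$ congruent to $n_l$ modulo $p^l$. Moreover, for $l>1$, with a representative $n_{l-1}\ge M_{l-1}$, $n_l$ satisfies $n_l\equiv n_{l-1}-\frac{p\,a_{n_{l-1}}}{a_{n_1+p}-a_{n_1}}\pmod{p^l}$.
   Context: $\mathbb{N}=\{0,1,2,\dots\}$; $v_p$ is the $p$-adic valuation with $v_p(0)=+\infty$; for rational (or $p$-adic) numbers $x,y$, $x\equiv y\pmod{p^j}$ means $v_p(x-y)\ge j$. *)

theory Defs
  imports
    "HOL-Computational_Algebra.Computational_Algebra"
    "HOL-Number_Theory.Cong"
    "HOL-Library.Extended_Real"
begin

text \<open>
  The p-adic valuation on the rationals. The case distinction is needed because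
  \<^const>\<open>multiplicity\<close> is 0, not infinity, at 0.
\<close>

definition pval :: "nat \<Rightarrow> rat \<Rightarrow> ereal" where
  "pval p x =
     (if x = 0 then \<infinity>
      else case quotient_of x of (u, v) \<Rightarrow>
        ereal (real (multiplicity (int p) u) - real (multiplicity (int p) v)))"

definition pcong :: "nat \<Rightarrow> nat \<Rightarrow> rat \<Rightarrow> rat \<Rightarrow> bool" where
  "pcong p j x y \<longleftrightarrow> pval p (x - y) \<ge> ereal (real j)"

text \<open>On integers this is the usual divisibility and congruence.\<close>

lemma pval_of_int_ge_iff:
  assumes "prime p"
  shows "pval p (of_int x) \<ge> ereal (real j) \<longleftrightarrow> int p ^ j dvd x"
proof (cases "x = 0")
  case False
  have "\<not> is_unit (int p)"
    using assms by (simp add: prime_nat_iff)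
  then show ?thesis
    using False by (simp add: pval_def power_dvd_iff_le_multiplicity quotient_of_int)
qed (simp add: pval_def)

lemma pcong_of_int_iff:
  assumes "prime p"
  shows "pcong p j (of_int x) (of_int y) \<longleftrightarrow> [x = y] (mod (int p ^ j))"
  unfolding pcong_def of_int_diff [symmetric] pval_of_int_ge_iff [OF assms]
  by (simp add: cong_iff_dvd_diff)

text \<open>
  \<open>unique_mod N P m\<close>: the integer \<open>m\<close> satisfies \<open>P\<close> and is unique modulo \<open>N\<close>.
\<close>

definition unique_mod :: "int \<Rightarrow> (int \<Rightarrow> bool) \<Rightarrow> int \<Rightarrow> bool" where
  "unique_mod N P m \<longleftrightarrow> P m \<and> (\<forall>m'. P m' \<longrightarrow> [m' = m] (mod N))"

end

theory Submission
  imports Defs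
begin

text \<open>
  Unfolding the recursion shows that on \<open>n \<ge> M j\<close> the sequence agrees modulo \<open>p ^ (j + 1)\<close> with an
  integer polynomial \<open>B j\<close>, because the error term is a multiple of a product of values of \<open>f\<close>
  at consecutive integers, \<open>j + 1\<close> of which are divisible by \<open>p\<close> (or one of which vanishes).
  Taylor expansion then gives \<open>a n \<equiv> a r + (n - r) d (mod p ^ (k + 1))\<close> for \<open>n \<equiv> r (mod p ^ k)\<close>,
  where \<open>p d \<equiv> a (r + p) - a r (mod p ^ 2)\<close>, and everything follows as in Hensel's lemma.
\<close>

section \<open>The valuation\<close>

lemma pval_of_int:
  "x \<noteq> 0 \<Longrightarrow> pval p (of_int x) = ereal (real (multiplicity (int p) x))"
  by (simp add: pval_def quotient_of_int)

lemma pval_of_int_gt_1_iff: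
  assumes "prime p"
  shows "pval p (of_int x) > 1 \<longleftrightarrow> int p ^ 2 dvd x"
proof (cases "x = 0")
  case False
  \<comment> \<open>The valuation of a nonzero integer is a natural number, so exceeding 1 means
    being at least 2.\<close>
  have "pval p (of_int x) > 1 \<longleftrightarrow> pval p (of_int x) \<ge> ereal (real 2)"
    by (auto simp: pval_of_int [OF False] one_ereal_def)
  then show ?thesis
    using pval_of_int_ge_iff [OF assms] by blast
qed (simp add: pval_def)

lemma pval_of_int_eq_1_iff:
  assumes "prime p"
  shows "pval p (of_int x) = 1 \<longleftrightarrow> int p dvd x \<and> \<not> int p ^ 2 dvd x"
proof -
  have "pval p (of_int x) = 1 \<longleftrightarrow> pval p (of_int x) \<ge> ereal (real 1) \<and> \<not> pval p (of_int x) > 1"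
    by (auto simp: one_ereal_def)
  then show ?thesis
    using pval_of_int_ge_iff [OF assms, of 1 x] pval_of_int_gt_1_iff [OF assms] by simp
qed

text \<open>A denominator prime to \<open>p\<close> does not affect the valuation. With
  \<open>u / v\<close> the reduced form, \<open>x * v = u * d\<close> and coprimality give
  \<open>v dvd d\<close>, so \<open>v\<close> is prime to \<open>p\<close> too, and \<open>u\<close>
  and \<open>x\<close> are divisible by the same powers of \<open>p\<close>.\<close>

lemma pval_of_int_divide_ge_iff:
  assumes "prime p" "\<not> int p dvd d"
  shows "pval p (of_int x / of_int d) \<ge> ereal (real j) \<longleftrightarrow> int p ^ j dvd x"
proof (cases "x = 0")
  case False
  obtain u v where uv: "quotient_of (of_int x / of_int d) = (u, v)"
    by fastforce
  have d: "d \<noteq> 0"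
    using assms by auto
  have v: "v > 0" and cop: "coprime u v"
    using uv by (auto intro: quotient_of_denom_pos quotient_of_coprime)
  have "(of_int x / of_int d :: rat) = of_int u / of_int v"
    using uv by (rule quotient_of_div)
  then have "(of_int (x * v) :: rat) = of_int (u * d)"
    using d v by (simp add: field_simps)
  then have eq: "x * v = u * d"
    by (simp only: of_int_eq_iff)
  have "v dvd u * d"
    using eq by (metis dvd_triv_right)
  then have "v dvd d"
    using cop by (metis coprime_commute coprime_dvd_mult_right_iff)
  then have pv: "\<not> int p dvd v"
    using assms by (meson dvd_trans)
  have prime: "prime (int p)"
    using assms by simp
  have dvd_u: "int p ^ j dvd u \<longleftrightarrow> int p ^ j dvd x"
  proof -
    have "coprime (int p ^ j) d" "coprime (int p ^ j) v"
      using prime assms(2) pv by (auto intro: prime_imp_coprime)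
    then have "int p ^ j dvd u \<longleftrightarrow> int p ^ j dvd u * d" "int p ^ j dvd x \<longleftrightarrow> int p ^ j dvd x * v"
      by (simp_all add: coprime_dvd_mult_left_iff)
    then show ?thesis
      using eq by simp
  qed
  have "multiplicity (int p) v = 0"
    using pv by (simp add: not_dvd_imp_multiplicity_0)
  moreover have "u \<noteq> 0"
    using eq False v by auto
  ultimately have "pval p (of_int x / of_int d) = pval p (of_int u)"
    using False d by (simp add: pval_def uv quotient_of_int)
  then show ?thesis
    using pval_of_int_ge_iff [OF assms(1)] dvd_u by simp
qed (simp add: pval_def)

section \<open>Integer polynomials modulo prime powers\<close>

text \<open>The quadratic remainder is integral: \<open>pCons\<close> turns the old remainder
  \<open>c\<close> into \<open>poly (pderiv B) x + (x + h) * c\<close>, so no division by 2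
  occurs.\<close>

lemma poly_int_taylor:
  fixes B :: "int poly"
  shows "\<exists>c. poly B (x + h) = poly B x + h * poly (pderiv B) x + h ^ 2 * c"
proof (induction B)
  case (pCons b B)
  then obtain c where c: "poly B (x + h) = poly B x + h * poly (pderiv B) x + h ^ 2 * c"
    by blast
  have "poly (pCons b B) (x + h) = poly (pCons b B) x + h * poly (pderiv (pCons b B)) x
      + h ^ 2 * (poly (pderiv B) x + (x + h) * c)"
    by (simp only: poly_pCons pderiv_pCons poly_add c) (simp add: algebra_simps power2_eq_square)
  then show ?case
    by blast
qed simp

lemma poly_int_cong:
  fixes B :: "int poly"
  assumes "[x = y] (mod q)"
  shows "[poly B x = poly B y] (mod q)"
proof (induction B)
  case (pCons b B)
  show ?case
    unfolding poly_pCons by (intro cong_add cong_mult cong_refl assms pCons.IH)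
qed simp

text \<open>As \<open>x - r\<close> is a multiple of \<open>p ^ k\<close>, replacing the derivative
  by \<open>d\<close> costs a multiple of \<open>p ^ (k + 1)\<close>. The quadratic term is a
  multiple of \<open>p ^ (2 * k)\<close>, and \<open>2 * k \<ge> k + 1\<close> because
  \<open>k > 0\<close>.\<close>

lemma poly_int_cong_linear:
  fixes B :: "int poly"
  assumes "k > 0" "[x = r] (mod (int p ^ k))" "[poly (pderiv B) r = d] (mod (int p))"
  shows "[poly B x = poly B r + (x - r) * d] (mod (int p ^ (k + 1)))"
proof -
  obtain z where z: "x - r = int p ^ k * z"
    using assms(2) by (auto simp: cong_iff_dvd_diff)
  obtain w where w: "poly (pderiv B) r - d = int p * w"
    using assms(3) by (auto simp: cong_iff_dvd_diff)
  obtain c where c: "poly B (r + (x - r))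
      = poly B r + (x - r) * poly (pderiv B) r + (x - r) ^ 2 * c"
    using poly_int_taylor by blast
  have "poly B x - (poly B r + (x - r) * d)
      = (x - r) * (poly (pderiv B) r - d) + (x - r) ^ 2 * c"
    using c by (simp add: algebra_simps)
  also have "\<dots> = int p ^ (k + 1) * (z * w) + int p ^ (2 * k) * (z ^ 2 * c)"
    unfolding z w by (simp add: algebra_simps power_mult power2_eq_square)
  also have "int p ^ (k + 1) dvd \<dots>"
    using assms(1) by (intro dvd_add dvd_mult2 le_imp_power_dvd) auto
  finally show ?thesis
    by (simp add: cong_iff_dvd_diff)
qed

text \<open>The uniqueness half of Hensel's lemma: \<open>poly B x - poly B y\<close> is
  \<open>x - y\<close> times a factor congruent to the derivative at \<open>y\<close> modulo
  \<open>p\<close>, hence coprime to \<open>p ^ l\<close>.\<close>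

lemma poly_int_root_unique_mod:
  fixes B :: "int poly"
  assumes "prime p" "[x = y] (mod (int p))" "\<not> int p dvd poly (pderiv B) y"
    and "int p ^ l dvd poly B x" "int p ^ l dvd poly B y"
  shows "[x = y] (mod (int p ^ l))"
proof -
  obtain c where c: "poly B (y + (x - y))
      = poly B y + (x - y) * poly (pderiv B) y + (x - y) ^ 2 * c"
    using poly_int_taylor by blast
  then have "poly B x - poly B y = (x - y) * (poly (pderiv B) y + (x - y) * c)"
    by (simp add: algebra_simps power2_eq_square)
  moreover have "int p ^ l dvd poly B x - poly B y"
    using assms(4,5) by simp
  moreover have "coprime (int p ^ l) (poly (pderiv B) y + (x - y) * c)"
  proof -
    have "int p dvd (x - y) * c"
      using assms(2) by (simp add: cong_iff_dvd_diff)
    then have "\<not> int p dvd poly (pderiv B) y + (x - y) * c"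
      using assms(3) by (simp add: dvd_add_left_iff)
    then show ?thesis
      using assms(1) by (auto intro: prime_imp_coprime)
  qed
  ultimately show ?thesis
    by (simp add: cong_iff_dvd_diff coprime_dvd_mult_left_iff)
qed

lemma ex_nat_cong_ge:
  fixes m q :: int
  assumes "q > 0"
  shows "\<exists>n\<ge>N. [int n = m] (mod q)"
proof (intro exI conjI)
  let ?n = "nat (m mod q + q * int N)"
  have "q * int N \<ge> 1 * int N"
    using assms by (intro mult_right_mono) auto
  moreover have m: "m mod q \<ge> 0"
    using assms by simp
  ultimately show "?n \<ge> N"
    by linarith
  show "[int ?n = m] (mod q)"
    using assms m by (simp add: cong_def)
qed

text \<open>One Newton step. Write \<open>b = p ^ k * \<beta>\<close> and let \<open>u\<close>
  invert \<open>d\<close> modulo \<open>p\<close>; then \<open>r - p ^ k * (\<beta> * u)\<close> is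
  a solution.\<close>

lemma ex_linear_solution_mod_prime_power:
  assumes "prime p" "\<not> int p dvd d" "int p ^ k dvd b"
  shows "\<exists>x. [x = r] (mod (int p ^ k)) \<and> int p ^ (k + 1) dvd b + (x - r) * d"
proof -
  obtain \<beta> where \<beta>: "b = int p ^ k * \<beta>"
    using assms(3) by blast
  have "coprime d (int p)"
    using assms(1,2) by (metis coprime_commute prime_imp_coprime prime_nat_int_transfer)
  then obtain u where u: "[d * u = 1] (mod (int p))"
    using cong_solve_coprime_int by blast
  have "[\<beta> * (d * u) = \<beta> * 1] (mod (int p))"
    by (intro cong_mult cong_refl u)
  then have "int p dvd \<beta> - \<beta> * (d * u)"
    by (metis cong_iff_dvd_diff cong_sym mult.right_neutral)
  then have "int p ^ (k + 1) dvd int p ^ k * (\<beta> - \<beta> * (d * u))"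
    by (simp add: mult_dvd_mono mult.commute)
  then have "int p ^ (k + 1) dvd b + ((r - int p ^ k * (\<beta> * u)) - r) * d"
    by (simp add: \<beta> algebra_simps)
  moreover have "[r - int p ^ k * (\<beta> * u) = r] (mod (int p ^ k))"
    by (simp add: cong_iff_dvd_diff)
  ultimately show ?thesis
    by blast
qed

section \<open>Sequences approximated by polynomials\<close>

text \<open>This isolates what the Hensel argument needs from the recursion, in cases (i) and (ii)
  alike. Level \<open>j\<close> has precision \<open>p ^ (j + 1)\<close> because the step from
  \<open>p ^ k\<close> to \<open>p ^ (k + 1)\<close> takes place on
  \<open>n \<ge> M k\<close>.\<close>

locale poly_approx =
  fixes p :: nat and a :: "nat \<Rightarrow> int" and M :: "nat \<Rightarrow> nat" and B :: "nat \<Rightarrow> int poly"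
  assumes prime: "prime p"
    and mono: "mono M"
    and approx: "n \<ge> M j \<Longrightarrow> [a n = poly (B j) (int n)] (mod (int p ^ (j + 1)))"
begin

text \<open>Translates the condition on all large indices in a residue class into a condition at one
  integer \<open>m\<close>, possibly negative. The class contains some \<open>n \<ge> N\<close>, so
  the right-hand side is never vacuous; the free threshold \<open>N\<close> allows different levels
  to be compared.\<close>

lemma dvd_poly_iff:
  assumes "N \<ge> M j" "l \<le> j + 1"
  shows "int p ^ l dvd poly (B j) m \<longleftrightarrow>
    (\<forall>n\<ge>N. [int n = m] (mod (int p ^ l)) \<longrightarrow> int p ^ l dvd a n)"
proof -
  have *: "int p ^ l dvd a n \<longleftrightarrow> int p ^ l dvd poly (B j) m"
    if "n \<ge> N" "[int n = m] (mod (int p ^ l))" for n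
  proof -
    have "[a n = poly (B j) (int n)] (mod (int p ^ l))"
      using approx [of j n] that assms
      by (meson cong_dvd_modulus le_imp_power_dvd order_trans)
    also have "[poly (B j) (int n) = poly (B j) m] (mod (int p ^ l))"
      using that(2) by (rule poly_int_cong)
    finally show ?thesis
      by (rule cong_dvd_iff)
  qed
  moreover obtain n where "n \<ge> N" "[int n = m] (mod (int p ^ l))"
    using ex_nat_cong_ge [of "int p ^ l"] prime by (metis of_nat_0_less_iff prime_gt_0_nat zero_less_power)
  ultimately show ?thesis
    by blast
qed

text \<open>Taylor expansion with increment \<open>p\<close>, whose quadratic term vanishes modulo
  \<open>p ^ 2\<close>. The condition \<open>j > 0\<close> makes \<open>B j\<close> accurate modulo
  \<open>p ^ 2\<close>.\<close>

lemma diff_cong_pderiv: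
  assumes "n \<ge> M j" "j > 0" "[int n = x] (mod (int p))"
  shows "[a (n + p) - a n = int p * poly (pderiv (B j)) x] (mod (int p ^ 2))"
proof -
  have a: "[a i = poly (B j) (int i)] (mod (int p ^ 2))" if "i \<ge> M j" for i
    using assms(2) by (intro cong_dvd_modulus [OF approx [OF that]] le_imp_power_dvd) simp
  have "[poly (pderiv (B j)) (int n) = poly (pderiv (B j)) x] (mod (int p))"
    using assms(3) by (rule poly_int_cong)
  then have "[poly (B j) (int (n + p)) = poly (B j) (int n)
      + (int (n + p) - int n) * poly (pderiv (B j)) x] (mod (int p ^ (1 + 1)))"
    by (intro poly_int_cong_linear) (auto simp: cong_def)
  then have "[poly (B j) (int (n + p)) - poly (B j) (int n)
      = int p * poly (pderiv (B j)) x] (mod (int p ^ 2))"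
    by (simp add: cong_iff_dvd_diff algebra_simps numeral_2_eq_2)
  moreover have "[a (n + p) - a n = poly (B j) (int (n + p)) - poly (B j) (int n)] (mod (int p ^ 2))"
    using assms(1) by (intro cong_diff a) auto
  ultimately show ?thesis
    using cong_trans by blast
qed

text \<open>
  As \<open>n\<close> need only exceed \<open>M 1\<close>, one difference quotient serves for all levels \<open>j\<close>;
  the comparison between levels goes through a large \<open>n'\<close> in the residue class of \<open>n\<close>.
\<close>

lemma pderiv_cong:
  assumes "n \<ge> M 1" "j > 0" "[x = int n] (mod (int p))" "a (n + p) - a n = int p * d"
  shows "[poly (pderiv (B j)) x = d] (mod (int p))"
proof -
  obtain n' where n': "n' \<ge> M j" "[int n' = int n] (mod (int p))"
    using ex_nat_cong_ge [of "int p" "M j" "int n"] prime prime_gt_0_nat by auto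
  have "M 1 \<le> M j"
    using assms(2) by (intro monoD [OF mono]) auto
  then have n'1: "n' \<ge> M 1"
    using n' by simp
  have "[int p * poly (pderiv (B j)) x = a (n' + p) - a n'] (mod (int p ^ 2))"
    using n' assms by (intro cong_sym [OF diff_cong_pderiv]) (auto intro: cong_trans cong_sym)
  also have "[a (n' + p) - a n' = int p * poly (pderiv (B 1)) (int n)] (mod (int p ^ 2))"
    using n' n'1 by (intro diff_cong_pderiv) auto
  also have "[int p * poly (pderiv (B 1)) (int n) = a (n + p) - a n] (mod (int p ^ 2))"
    using assms by (intro cong_sym [OF diff_cong_pderiv]) auto
  finally have "int p ^ 2 dvd int p * (poly (pderiv (B j)) x - d)"
    unfolding assms(4) by (simp add: cong_iff_dvd_diff right_diff_distrib)
  then show ?thesis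
    using prime prime_gt_0_nat by (simp add: cong_iff_dvd_diff power2_eq_square)
qed

text \<open>The slope \<open>d\<close> is measured at \<open>n\<close> but the expansion is around
  \<open>r\<close>. This lets the base point move during lifting while the difference quotient stays
  that of the initial index.\<close>

lemma poly_cong_linear:
  assumes "n \<ge> M 1" "k > 0" "a (n + p) - a n = int p * d" "[int r = int n] (mod (int p))"
    and "r \<ge> M k" "[x = int r] (mod (int p ^ k))"
  shows "[poly (B k) x = a r + (x - int r) * d] (mod (int p ^ (k + 1)))"
proof -
  have "[poly (B k) x = poly (B k) (int r) + (x - int r) * d] (mod (int p ^ (k + 1)))"
    using assms by (intro poly_int_cong_linear pderiv_cong) auto
  also have "[poly (B k) (int r) + (x - int r) * d = a r + (x - int r) * d] (mod (int p ^ (k + 1)))"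
    using assms by (intro cong_add cong_refl cong_sym [OF approx])
  finally show ?thesis .
qed

section \<open>Roots of the approximating polynomials: Newton's formula and Hensel lifting\<close>

lemma dvd_poly_iff_pcong:
  assumes "n \<ge> M 1" "k > 0" "a (n + p) - a n = int p * d" "[int r = int n] (mod (int p))"
    and "r \<ge> M k" "[x = int r] (mod (int p ^ k))" "\<not> int p dvd d"
  shows "int p ^ (k + 1) dvd poly (B k) x \<longleftrightarrow>
    pcong p (k + 1) (of_int x) (of_nat r - of_nat p * of_int (a r) / of_int (a (n + p) - a n))"
proof -
  have "p > 0" "d \<noteq> 0"
    using prime prime_gt_0_nat assms(7) by auto
  \<comment> \<open>Cancelling \<open>p\<close> leaves the linear approximation over
    \<open>d\<close>, a unit at \<open>p\<close>, so only the numerator matters.\<close>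
  then have "(of_int x - (of_nat r - of_nat p * of_int (a r) / of_int (a (n + p) - a n)) :: rat)
      = of_int (a r + (x - int r) * d) / of_int d"
    unfolding assms(3) by (simp add: field_simps)
  then have "pcong p (k + 1) (of_int x)
      (of_nat r - of_nat p * of_int (a r) / of_int (a (n + p) - a n))
      \<longleftrightarrow> int p ^ (k + 1) dvd a r + (x - int r) * d"
    unfolding pcong_def by (simp only: pval_of_int_divide_ge_iff [OF prime assms(7)])
  then show ?thesis
    using cong_dvd_iff [OF poly_cong_linear [OF assms(1-6)]] by blast
qed

lemma ex_dvd_poly:
  assumes "n \<ge> M 1" "k > 0" "a (n + p) - a n = int p * d" "[int r = int n] (mod (int p))"
    and "r \<ge> M k" "\<not> int p dvd d" "int p ^ k dvd a r"
  shows "\<exists>x. [x = int r] (mod (int p ^ k)) \<and> int p ^ (k + 1) dvd poly (B k) x"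
  using ex_linear_solution_mod_prime_power [OF prime assms(6,7), of "int r"]
    cong_dvd_iff [OF poly_cong_linear [OF assms(1-5)]] by blast

lemma root_unique_mod:
  assumes "n \<ge> M 1" "a (n + p) - a n = int p * d" "\<not> int p dvd d"
    and "[x = int n] (mod (int p))" "[y = int n] (mod (int p))" "l > 0"
    and "int p ^ l dvd poly (B (l - 1)) x" "int p ^ l dvd poly (B (l - 1)) y"
  shows "[x = y] (mod (int p ^ l))"
proof (cases "l = 1")
  \<comment> \<open>At level 0 the polynomial is accurate only modulo \<open>p\<close>, which says
    nothing about its derivative; but for \<open>l = 1\<close> the claim is just the common residue
    modulo \<open>p\<close>.\<close>
  case True
  then show ?thesis
    using assms by (auto intro: cong_trans cong_sym)
next
  case False
  then have "[poly (pderiv (B (l - 1))) y = d] (mod (int p))"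
    using assms by (intro pderiv_cong) auto
  then have "\<not> int p dvd poly (pderiv (B (l - 1))) y"
    using assms(3) cong_dvd_iff by blast
  then show ?thesis
    using assms by (intro poly_int_root_unique_mod [OF prime]) (auto intro: cong_trans cong_sym)
qed

lemma ex_root_mod:
  assumes "n \<ge> M 1" "a (n + p) - a n = int p * d" "\<not> int p dvd d" "int p dvd a n" "l > 0"
  shows "\<exists>x. [x = int n] (mod (int p)) \<and> int p ^ l dvd poly (B (l - 1)) x"
  using assms(5)
proof (induction l rule: nat_induct_non_zero)
  case 1
  have "M 0 \<le> M 1"
    by (intro monoD [OF mono]) auto
  then have "[a n = poly (B 0) (int n)] (mod (int p))"
    using approx [of 0 n] assms(1) by simp
  then have "int p dvd poly (B 0) (int n)"
    using assms(4) cong_dvd_iff by blast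
  then show ?case
    by (intro exI [of _ "int n"]) simp
next
  case (Suc l)
  then obtain x where x: "[x = int n] (mod (int p))" "int p ^ l dvd poly (B (l - 1)) x"
    by blast
  \<comment> \<open>The representative lies above \<open>M l\<close>, not just
    \<open>M (l - 1)\<close>: \<open>a r\<close> inherits divisibility from \<open>B (l - 1)\<close>
    and can then serve as base point for \<open>B l\<close>.\<close>
  obtain r where r: "r \<ge> M l" "[int r = x] (mod (int p ^ l))"
    using ex_nat_cong_ge [of "int p ^ l"] prime
    by (metis of_nat_0_less_iff prime_gt_0_nat zero_less_power)
  have weaken: "[u = v] (mod (int p))" if "[u = v] (mod (int p ^ l))" for u v
    using that \<open>l > 0\<close> by (elim cong_dvd_modulus) auto
  have rn: "[int r = int n] (mod (int p))"
    using weaken [OF r(2)] x(1) cong_trans by blast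
  have "M (l - 1) \<le> M l"
    by (intro monoD [OF mono]) auto
  then have "int p ^ l dvd a r"
    using dvd_poly_iff [of "l - 1" "M (l - 1)" l x] x(2) r \<open>l > 0\<close> by auto
  then obtain y where "[y = int r] (mod (int p ^ l))" "int p ^ (l + 1) dvd poly (B l) y"
    using ex_dvd_poly [OF assms(1) \<open>l > 0\<close> assms(2) rn r(1) assms(3)] by blast
  then show ?case
    using cong_trans [OF weaken rn] by (intro exI [of _ y]) simp
qed

end

section \<open>The recursion\<close>

text \<open>The result of unfolding the recursion \<open>L\<close> times and dropping the remaining
  term: the sum over \<open>i < L\<close> of \<open>h(X - i)\<close> times the product of
  \<open>f(X - t)\<close> for \<open>t < i\<close>. Composition with \<open>X - 1\<close> passes
  from index \<open>n\<close> to \<open>n - 1\<close>.\<close>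

fun truncated_sum :: "int poly \<Rightarrow> int poly \<Rightarrow> nat \<Rightarrow> int poly" where
  "truncated_sum f h 0 = 0"
| "truncated_sum f h (Suc L) = h + f * pcompose (truncated_sum f h L) [:-1, 1:]"

text \<open>
  The truncated subtraction in \<open>n + 1 - L\<close> is intended: the window of factors is cut off at \<open>0\<close>.
\<close>

lemma prod_dvd_diff_truncated_sum:
  fixes f h :: "int poly" and a :: "nat \<Rightarrow> int"
  assumes "a 0 = poly h 0"
    and "\<And>n. n > 0 \<Longrightarrow> a n = poly f (int n) * a (n - 1) + poly h (int n)"
  shows "(\<Prod>i\<in>{n + 1 - L..n}. poly f (int i)) dvd a n - poly (truncated_sum f h L) (int n)"
proof (induction L arbitrary: n)
  case (Suc L)
  show ?case
  proof (cases n)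
    case 0
    then show ?thesis
      by (simp add: assms(1) poly_pcompose)
  next
    case (Suc m)
    have "{n + 1 - Suc L..n} = insert n {m + 1 - L..m}"
      using Suc by auto
    then have "(\<Prod>i\<in>{n + 1 - Suc L..n}. poly f (int i))
        = poly f (int n) * (\<Prod>i\<in>{m + 1 - L..m}. poly f (int i))"
      using Suc by simp
    moreover have "a n - poly (truncated_sum f h (Suc L)) (int n)
        = poly f (int n) * (a m - poly (truncated_sum f h L) (int m))"
      using assms(2) [of n] Suc by (simp add: poly_pcompose algebra_simps)
    ultimately show ?thesis
      using Suc.IH [of m] by (simp only: mult_dvd_mono dvd_refl)
  qed
qed simp

text \<open>Among the \<open>(j + 1) * p\<close> integers ending at \<open>n\<close>, exactly
  \<open>j + 1\<close> are congruent to \<open>n0\<close> modulo \<open>p\<close>, and each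
  contributes a factor \<open>p\<close>. The bound on \<open>n\<close> keeps them all at or above
  \<open>n0\<close>, so the cut-off at 0 loses none.\<close>

lemma prime_power_dvd_prod_window:
  fixes f :: "int poly"
  assumes p: "p > 0" and f: "int p dvd poly f (int n0)" and n: "n \<ge> n0 + j * p"
  shows "int p ^ (j + 1) dvd (\<Prod>i\<in>{n + 1 - (j + 1) * p..n}. poly f (int i))"
proof -
  \<comment> \<open>The largest index up to \<open>n\<close> in the class of \<open>n0\<close>; the
    factors used are at \<open>t\<close>, \<open>t - p\<close>, ...,
    \<open>t - j * p\<close>.\<close>
  define t where "t = n - (n - n0) mod p"
  have t: "t \<le> n" "t + p > n" "t \<ge> n0 + j * p" "p dvd t - n0"
  proof -
    have t': "t = n0 + (n - n0) div p * p"
    proof -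
      have "n0 \<le> n"
        using n by simp
      moreover have "(n - n0) mod p + (n - n0) div p * p = n - n0"
        by simp
      ultimately show ?thesis
        unfolding t_def by linarith
    qed
    have "j \<le> (n - n0) div p"
      using n p by (simp add: less_eq_div_iff_mult_less_eq)
    then show "t \<ge> n0 + j * p"
      using t' by simp
    show "p dvd t - n0"
      using t' by simp
    show "t \<le> n"
      by (simp add: t_def)
    have "(n - n0) mod p < p"
      using p by simp
    then show "t + p > n"
      unfolding t_def by linarith
  qed
  define I where "I = (\<lambda>i. t - i * p) ` {..j}"
  have le: "i * p \<le> j * p" if "i \<le> j" for i
    using that by simp
  have "inj_on (\<lambda>i. t - i * p) {..j}"
  proof (rule inj_onI)
    fix i i' assume *: "i \<in> {..j}" "i' \<in> {..j}" "t - i * p = t - i' * p"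
    \<comment> \<open>These bounds make the natural-number subtractions exact.\<close>
    have "i * p \<le> t" "i' * p \<le> t"
      using *(1,2) le_trans [OF le add_leD2 [OF t(3)]] by auto
    then have "i * p = i' * p"
      using *(3) by linarith
    then show "i = i'"
      using p by simp
  qed
  then have "card I = j + 1"
    by (simp add: I_def card_image)
  moreover have "int p dvd poly f (int i)" if i: "i \<in> I" for i
  proof -
    obtain i' where i': "i' \<le> j" "i = t - i' * p"
      using i by (auto simp: I_def)
    have "n0 + i' * p \<le> t"
      using le [OF i'(1)] t(3) by linarith
    then have "int i - int n0 = int (t - n0) - int i' * int p"
      using i'(2) by (simp add: of_nat_diff)
    then have "[int i = int n0] (mod (int p))"
      using t(4) by (simp add: cong_iff_dvd_diff)
    then have "[poly f (int i) = poly f (int n0)] (mod (int p))"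
      by (rule poly_int_cong)
    then show ?thesis
      using f cong_dvd_iff by blast
  qed
  then have "(\<Prod>i\<in>I. int p) dvd (\<Prod>i\<in>I. poly f (int i))"
    by (intro prod_dvd_prod)
  moreover have "I \<subseteq> {n + 1 - (j + 1) * p..n}"
  proof
    fix i assume "i \<in> I"
    then obtain i' where i': "i' \<le> j" "i = t - i' * p"
      by (auto simp: I_def)
    have "n + 1 - (j * p + p) \<le> t - i' * p" "t - i' * p \<le> n"
      using le [OF i'(1)] t(1-3) by linarith+
    then show "i \<in> {n + 1 - (j + 1) * p..n}"
      by (simp add: i'(2) add.commute)
  qed
  then have "(\<Prod>i\<in>I. poly f (int i)) dvd (\<Prod>i\<in>{n + 1 - (j + 1) * p..n}. poly f (int i))"
    by (intro prod_dvd_prod_subset) auto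
  ultimately show ?thesis
    using dvd_trans by simp
qed

lemma poly_approx_truncated_sum:
  fixes f h :: "int poly" and a :: "nat \<Rightarrow> int"
  assumes a_0: "a 0 = poly h 0"
    and a_rec: "\<And>n. n > 0 \<Longrightarrow> a n = poly f (int n) * a (n - 1) + poly h (int n)"
    and p: "prime p"
    and M: "(poly f (int n0) = 0 \<and> (\<forall>j. M j = n0)) \<or>
            (int p dvd poly f (int n0) \<and> (\<forall>j. M j = n0 + j * p))"
  shows "poly_approx p a M (\<lambda>j. truncated_sum f h ((j + 1) * p))"
proof
  show "prime p"
    by (fact p)
  show "mono M"
    using M by (auto intro!: monoI)
  fix n j assume n: "n \<ge> M j"
  have "int p ^ (j + 1) dvd (\<Prod>i\<in>{n + 1 - (j + 1) * p..n}. poly f (int i))"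
  \<comment> \<open>The split is by the size of \<open>n\<close>, not by cases (i) and (ii), since
    \<open>p\<close> divides \<open>poly f n0\<close> in both. A smaller \<open>n\<close> can occur
    only in case (i), and then the window contains the zero \<open>n0\<close> itself.\<close>
  proof (cases "n \<ge> n0 + j * p")
    case True
    moreover have "int p dvd poly f (int n0)"
      using M by auto
    ultimately show ?thesis
      using p prime_gt_0_nat by (intro prime_power_dvd_prod_window)
  next
    case False
    then have "poly f (int n0) = 0" "n0 \<le> n"
      using M n by auto
    moreover have "n0 \<in> {n + 1 - (j + 1) * p..n}"
      using False \<open>n0 \<le> n\<close> by auto
    ultimately have "(\<Prod>i\<in>{n + 1 - (j + 1) * p..n}. poly f (int i)) = 0"
      by (intro prod_zero bexI [of _ n0]) simp_all
    then show ?thesis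
      by (simp only: dvd_0_right)
  qed
  then show "[a n = poly (truncated_sum f h ((j + 1) * p)) (int n)] (mod (int p ^ (j + 1)))"
    using prod_dvd_diff_truncated_sum [of a h f n "(j + 1) * p"] a_0 a_rec dvd_trans
    unfolding cong_iff_dvd_diff by blast
qed

section \<open>Transfer of the polynomial results to the sequence\<close>

theorem theorem5:
  fixes f h1 :: "int poly" and a :: "nat \<Rightarrow> int"
    and p k n0 nk :: nat and M :: "nat \<Rightarrow> nat"
  assumes a_0: "a 0 = poly h1 0"
    and a_rec: "\<And>n. n > 0 \<Longrightarrow> a n = poly f (int n) * a (n - 1) + poly h1 (int n)"
    and p: "prime p"
    and k: "k > 0"
    and M: "(poly f (int n0) = 0 \<and> (\<forall>j. M j = n0)) \<or>
            (int p dvd poly f (int n0) \<and> (\<forall>j. M j = n0 + j * p))"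
    and nk: "nk \<ge> M k" "int p ^ k dvd a nk"
  shows
    "(pval p (of_int (a (nk + p) - a nk)) = 1 \<longrightarrow>
       (\<exists>m::int.
          unique_mod (int p ^ (k + 1))
            (\<lambda>m. [m = int nk] (mod (int p ^ k)) \<and>
                 (\<forall>n\<ge>M k. [int n = m] (mod (int p ^ (k + 1))) \<longrightarrow> int p ^ (k + 1) dvd a n)) m \<and>
          pcong p (k + 1) (of_int m)
            (of_nat nk - of_nat p * of_int (a nk) / of_int (a (nk + p) - a nk))))
     \<and>
     (pval p (of_int (a (nk + p) - a nk)) > 1 \<and> int p ^ (k + 1) dvd a nk \<longrightarrow>
       (\<forall>n. [n = nk] (mod (p ^ k)) \<and> n \<ge> M k \<longrightarrow> int p ^ (k + 1) dvd a n))
     \<and>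
     (pval p (of_int (a (nk + p) - a nk)) > 1 \<and> \<not> int p ^ (k + 1) dvd a nk \<longrightarrow>
       (\<forall>n. [n = nk] (mod (p ^ k)) \<and> n \<ge> M k \<longrightarrow> \<not> int p ^ (k + 1) dvd a n))
     \<and>
     (k = 1 \<and> int p dvd a nk \<and> pval p (of_int (a (nk + p) - a nk)) = 1 \<longrightarrow>
       (\<exists>c::nat \<Rightarrow> int.
          (\<forall>l>0. unique_mod (int p ^ l)
             (\<lambda>m. [m = int nk] (mod (int p)) \<and>
                  (\<forall>n\<ge>M (l - 1). [int n = m] (mod (int p ^ l)) \<longrightarrow>
                     pval p (of_int (a n)) \<ge> ereal (real l))) (c l)) \<and>
          (\<forall>l>1. \<forall>r\<ge>M (l - 1). [int r = c (l - 1)] (mod (int p ^ (l - 1))) \<longrightarrow>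
             pcong p l (of_int (c l))
               (of_nat r - of_nat p * of_int (a r) / of_int (a (nk + p) - a nk)))))"
proof -
  define B where "B = (\<lambda>j. truncated_sum f h1 ((j + 1) * p))"
  interpret poly_approx p a M B
    unfolding B_def using poly_approx_truncated_sum [of a h1 f p n0 M] a_0 a_rec p M by blast
  let ?D = "a (nk + p) - a nk"
  have "M 1 \<le> M k"
    using k by (intro monoD [OF mono]) auto
  then have nk1: "nk \<ge> M 1"
    using nk by simp
  have val_1: "\<exists>d. ?D = int p * d \<and> \<not> int p dvd d" if "pval p (of_int ?D) = 1"
  proof -
    have "int p dvd ?D" "\<not> int p ^ 2 dvd ?D"
      using that pval_of_int_eq_1_iff [OF p] by blast+
    then show ?thesis
      by (auto simp: power2_eq_square elim!: dvdE)
  qed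
  have part1: "\<exists>m. unique_mod (int p ^ (k + 1))
      (\<lambda>m. [m = int nk] (mod (int p ^ k)) \<and>
           (\<forall>n\<ge>M k. [int n = m] (mod (int p ^ (k + 1))) \<longrightarrow> int p ^ (k + 1) dvd a n)) m \<and>
      pcong p (k + 1) (of_int m) (of_nat nk - of_nat p * of_int (a nk) / of_int ?D)"
    if val: "pval p (of_int ?D) = 1"
  proof -
    obtain d where d: "?D = int p * d" "\<not> int p dvd d"
      using val_1 [OF val] by blast
    obtain m where m: "[m = int nk] (mod (int p ^ k))" "int p ^ (k + 1) dvd poly (B k) m"
      using ex_dvd_poly [OF nk1 k d(1) cong_refl nk(1) d(2) nk(2)] by blast
    have weaken: "[u = v] (mod (int p))" if "[u = v] (mod (int p ^ k))" for u v
      using that k by (elim cong_dvd_modulus) auto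
    have "[m' = m] (mod (int p ^ (k + 1)))"
      if "[m' = int nk] (mod (int p ^ k))" "int p ^ (k + 1) dvd poly (B k) m'" for m'
      using root_unique_mod [OF nk1 d weaken weaken, of m' m "k + 1"] that m by simp
    then have "unique_mod (int p ^ (k + 1))
      (\<lambda>m. [m = int nk] (mod (int p ^ k)) \<and> int p ^ (k + 1) dvd poly (B k) m) m"
      using m by (simp add: unique_mod_def)
    then show ?thesis
      using m dvd_poly_iff_pcong [OF nk1 k d(1) cong_refl nk(1) m(1) d(2)]
      unfolding dvd_poly_iff [OF order_refl order_refl] by blast
  qed
  \<comment> \<open>Here the slope is divisible by \<open>p\<close>, so the linear term vanishes and
    \<open>a n\<close> is congruent to \<open>a nk\<close> modulo \<open>p ^ (k + 1)\<close>. This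
    gives (2) and (3) together.\<close>
  have part23: "int p ^ (k + 1) dvd a n \<longleftrightarrow> int p ^ (k + 1) dvd a nk"
    if val: "pval p (of_int ?D) > 1" and n: "[n = nk] (mod (p ^ k))" "n \<ge> M k" for n
  proof -
    have "int p ^ 2 dvd ?D"
      using val by (simp only: pval_of_int_gt_1_iff [OF p])
    then obtain d where d: "?D = int p * (int p * d)"
      unfolding power2_eq_square mult.assoc dvd_def by blast
    have n': "[int n = int nk] (mod (int p ^ k))"
      using n(1) by (metis cong_int_iff of_nat_power)
    have "[a n = poly (B k) (int n)] (mod (int p ^ (k + 1)))"
      using n(2) by (rule approx)
    also have "[poly (B k) (int n) = a nk + (int n - int nk) * (int p * d)] (mod (int p ^ (k + 1)))"
      by (rule poly_cong_linear [OF nk1 k d cong_refl nk(1) n'])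
    also have "[a nk + (int n - int nk) * (int p * d) = a nk + 0] (mod (int p ^ (k + 1)))"
    proof (intro cong_add cong_refl)
      have "int p ^ k * int p dvd (int n - int nk) * (int p * d)"
        using n' by (intro mult_dvd_mono) (auto simp: cong_iff_dvd_diff)
      then show "[(int n - int nk) * (int p * d) = 0] (mod (int p ^ (k + 1)))"
        by (simp add: cong_0_iff mult.commute)
    qed
    finally show ?thesis
      by (simp add: cong_dvd_iff)
  qed
  have part4: "\<exists>c::nat \<Rightarrow> int.
      (\<forall>l>0. unique_mod (int p ^ l)
         (\<lambda>m. [m = int nk] (mod (int p)) \<and>
              (\<forall>n\<ge>M (l - 1). [int n = m] (mod (int p ^ l)) \<longrightarrow>
                 pval p (of_int (a n)) \<ge> ereal (real l))) (c l)) \<and>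
      (\<forall>l>1. \<forall>r\<ge>M (l - 1). [int r = c (l - 1)] (mod (int p ^ (l - 1))) \<longrightarrow>
         pcong p l (of_int (c l)) (of_nat r - of_nat p * of_int (a r) / of_int ?D))"
    if val: "pval p (of_int ?D) = 1" and ank: "int p dvd a nk"
  proof -
    obtain d where d: "?D = int p * d" "\<not> int p dvd d"
      using val_1 [OF val] by blast
    define root where "root l x \<longleftrightarrow> [x = int nk] (mod (int p)) \<and> int p ^ l dvd poly (B (l - 1)) x" for l x
    \<comment> \<open>The roots are chosen independently at each level; their compatibility follows
      below from uniqueness.\<close>
    obtain c where c: "root l (c l)" if "l > 0" for l
      using ex_root_mod [OF nk1 d ank] unfolding root_def by metis
    have unique: "unique_mod (int p ^ l) (root l) (c l)" if "l > 0" for l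
      using root_unique_mod [OF nk1 d _ _ that] c [OF that] by (simp add: unique_mod_def root_def)
    have root_eq: "root l = (\<lambda>m. [m = int nk] (mod (int p)) \<and>
        (\<forall>n\<ge>M (l - 1). [int n = m] (mod (int p ^ l)) \<longrightarrow> pval p (of_int (a n)) \<ge> ereal (real l)))" for l
      unfolding root_def pval_of_int_ge_iff [OF p] by (subst dvd_poly_iff [of _ "M (l - 1)"]) auto
    have "pcong p l (of_int (c l)) (of_nat r - of_nat p * of_int (a r) / of_int ?D)"
      if l: "l > 1" and r: "r \<ge> M (l - 1)" "[int r = c (l - 1)] (mod (int p ^ (l - 1)))" for l r
    proof -
      obtain j where j: "l = Suc j" "j > 0"
        using l by (cases l) auto
      \<comment> \<open>To see that \<open>c l\<close> is also a root at level
        \<open>j = l - 1\<close>, pass from \<open>B j\<close> to \<open>B (j - 1)\<close> through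
        the values \<open>a n\<close> with \<open>n \<ge> M j\<close>, where both polynomials are
        accurate modulo \<open>p ^ j\<close>. Uniqueness then gives \<open>c l\<close> congruent to
        \<open>c j\<close>, hence to \<open>r\<close>, so \<open>r\<close> is a valid base
        point.\<close>
      have "M (j - 1) \<le> M j"
        by (intro monoD [OF mono]) auto
      moreover have "int p ^ j dvd poly (B j) (c l)"
        using c [of l] l j by (auto simp: root_def intro: dvd_trans [rotated])
      ultimately have "int p ^ j dvd poly (B (j - 1)) (c l)"
        using dvd_poly_iff [of j "M j" j "c l"] dvd_poly_iff [of "j - 1" "M j" j "c l"] by simp
      then have "root j (c l)"
        using c [of l] l by (simp add: root_def)
      then have "[c l = c j] (mod (int p ^ j))"
        using unique [OF j(2)] by (simp add: unique_mod_def)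
      then have cr: "[c l = int r] (mod (int p ^ j))"
        using r(2) j by (auto intro: cong_trans cong_sym)
      then have "[c l = int r] (mod (int p))"
        using j(2) by (elim cong_dvd_modulus) auto
      then have "[int r = int nk] (mod (int p))"
        using c [of l] l unfolding root_def by (meson cong_sym cong_trans zero_less_one less_trans)
      then show ?thesis
        using dvd_poly_iff_pcong [OF nk1 j(2) d(1) _ _ cr d(2)] r(1) c [of l] j
        by (simp add: root_def)
    qed
    then show ?thesis
      using unique unfolding root_eq by blast
  qed
  show ?thesis
    using part1 part23 part4 by blast
qed

end
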